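(* Let $\theta\in\{-1,1\}$ and $\beta>0$. There exists an $R_0>0$ sufficiently small such that if $|||F_0|||\le \frac{R_0}{2}$, then the quantum Boltzmann equation $$\partial_tF+v\cdot\nabla_xF=Q[F,F;F],\qquad F(0,x,v)=F_0(x,v),\qquad (t,x,v)\in\mathbb{R}_+\times\mathbb{R}^3\times\mathbb{R}^3,$$ has a unique mild solution $F\in S_{R_0}$.
   Context: Collision operator (dependence on $t,x$ suppressed): $$Q[F,F;F](v)=\int_{\mathbb{R}^3}\int_{\mathbb{S}^2}|\omega\cdot(v-u)|\Big[F(u')F(v')(1+\theta F(u)+\theta F(v))-F(u)F(v)(1+\theta F(u')+\theta F(v'))\Big]d\omega\,du,$$ where $u'=u+\omega(\omega\cdot(v-u))$, $v'=v-\omega(\omega\cdot(v-u))$. $\theta=-1$ corresponds to fermions, $\theta=1$ to bosons. Function space: $$S=\Big\{F\in C^0(\mathbb{R}_+\times\mathbb{R}^3\times\mathbb{R}^3):\ |F(t,x,v)|\le c\,e^{-\beta(|x|^2+|v|^2)}\text{ for some }c>0\Big\},\qquad |||F|||=\sup_{t,x,v}\Big(e^{\beta(|x|^2+|v|^2)}|F(t,x,v)|\Big),$$ and $S_R=\{F\in S:\ |||F|||\le R\}$. For the time-independent initial datum $F_0(x,v)$ the same norm reads $|||F_0|||=\sup_{x,v}e^{\beta(|x|^2+|v|^2)}|F_0(x,v)|$. For a function $F(t,x,v)$ put $F^{\#}(t,x,v)=F(t,x+tv,v)$ and $Q^{\#}[F,F;F](t,x,v)=Q[F,F;F](t,x+tv,v)$.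 A mild solution is a function $F\in S$ satisfying $$F^{\#}(t,x,v)=F_0(x,v)+\int_0^tQ^{\#}[F,F;F](\tau,x,v)\,d\tau .$$
   Formalization: Membership of the solution in S and S_{R_0} is imposed on F^#(t,x,v)=F(t,x+tv,v) instead of on F, since a time-uniform Gaussian bound on F contradicts conservation of energy and of the moment of |x-tv|^2 for nonzero nonnegative data; F_0 is taken continuous. *)

theory Defs
  imports "HOL-Analysis.Analysis"
begin

type_synonym vec3 = "real^3"

type_synonym phase_fun = "vec3 \<Rightarrow> vec3 \<Rightarrow> real"

text \<open>
  Functions of \<open>(t, x, v)\<close> are total in \<open>t\<close>; only the values at times \<open>t \<ge> 0\<close> are meaningful.
\<close>
type_synonym kinetic_fun = "real \<Rightarrow> phase_fun"


text \<open>
  Surface measure (not normalised) of the unit sphere of an \<open>n\<close>-dimensional Euclidean space, as in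
  polar coordinates: \<open>\<sigma>(A) = n \<cdot> Leb {r a | a \<in> A, 0 < r < 1}\<close>.
\<close>
definition sphere_measure :: "'a::euclidean_space measure" where
  "sphere_measure =
     scale_measure (of_nat DIM('a))
       (distr (restrict_space lborel (ball 0 1 - {0})) (restrict_space borel (sphere 0 1))
          (\<lambda>x. x /\<^sub>R norm x))"

lemma space_sphere_measure [simp]: "space (sphere_measure :: 'a::euclidean_space measure) = sphere 0 1"
  by (simp add: sphere_measure_def space_scale_measure space_restrict_space)

lemma normalize_measurable_sphere:
  "(\<lambda>x::'a::euclidean_space. x /\<^sub>R norm x)
     \<in> restrict_space lborel (ball 0 1 - {0}) \<rightarrow>\<^sub>M restrict_space borel (sphere 0 1)"
proof (rule measurable_restrict_space2)
  show "(\<lambda>x::'a. x /\<^sub>R norm x) \<in> space (restrict_space lborel (ball 0 1 - {0})) \<rightarrow> sphere 0 1"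
    by (auto simp: space_restrict_space)
  show "(\<lambda>x::'a. x /\<^sub>R norm x) \<in> restrict_space lborel (ball 0 1 - {0}) \<rightarrow>\<^sub>M borel"
    by (rule measurable_restrict_space1) measurable
qed

lemma emeasure_sphere_measure_space:
  "emeasure (sphere_measure :: vec3 measure) (sphere 0 1) = ennreal (4 * pi)"
proof -
  let ?B = "ball (0::vec3) 1 - {0}"
  have S: "sphere (0::vec3) 1 \<in> sets (restrict_space borel (sphere 0 1))"
    by (simp add: sets_restrict_space_iff)
  have "emeasure (sphere_measure :: vec3 measure) (sphere 0 1)
      = 3 * emeasure (restrict_space lborel ?B)
              ((\<lambda>x. x /\<^sub>R norm x) -` sphere 0 1 \<inter> space (restrict_space lborel ?B))"
    unfolding sphere_measure_def
    by (simp add: emeasure_distr[OF normalize_measurable_sphere S])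
  also have "(\<lambda>x. x /\<^sub>R norm x) -` sphere 0 1 \<inter> space (restrict_space lborel ?B) = ?B"
    by (auto simp: space_restrict_space)
  also have "emeasure (restrict_space lborel ?B) ?B = emeasure lborel ?B"
    by (simp add: emeasure_restrict_space)
  also have "\<dots> = emeasure lborel (ball (0::vec3) 1)"
    by (rule emeasure_Diff_null_set) (auto simp: null_sets_def)
  also have "\<dots> = ennreal (4 / 3 * pi)"
    by (simp add: emeasure_ball unit_ball_vol_numeral field_simps)
  also have "3 * ennreal (4 / 3 * pi) = ennreal (4 * pi)"
    using ennreal_mult[of 3 "4 / 3 * pi"] by simp
  finally show ?thesis .
qed


definition post_u :: "vec3 \<Rightarrow> vec3 \<Rightarrow> vec3 \<Rightarrow> vec3" where
  "post_u \<omega> u v = u + (\<omega> \<bullet> (v - u)) *\<^sub>R \<omega>"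

definition post_v :: "vec3 \<Rightarrow> vec3 \<Rightarrow> vec3 \<Rightarrow> vec3" where
  "post_v \<omega> u v = v - (\<omega> \<bullet> (v - u)) *\<^sub>R \<omega>"

definition collision :: "real \<Rightarrow> (vec3 \<Rightarrow> real) \<Rightarrow> vec3 \<Rightarrow> real" where
  "collision \<theta> f v =
     (\<integral>u. (\<integral>\<omega>. \<bar>\<omega> \<bullet> (v - u)\<bar> *
         (f (post_u \<omega> u v) * f (post_v \<omega> u v) * (1 + \<theta> * f u + \<theta> * f v)
          - f u * f v * (1 + \<theta> * f (post_u \<omega> u v) + \<theta> * f (post_v \<omega> u v)))
       \<partial>sphere_measure) \<partial>lborel)"

definition Q :: "real \<Rightarrow> kinetic_fun \<Rightarrow> kinetic_fun" where
  "Q \<theta> F t x v = collision \<theta> (F t x) v"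


definition sharp :: "kinetic_fun \<Rightarrow> kinetic_fun" where
  "sharp F t x v = F t (x + t *\<^sub>R v) v"


definition weight :: "real \<Rightarrow> vec3 \<Rightarrow> vec3 \<Rightarrow> real" where
  "weight \<beta> x v = exp (\<beta> * ((norm x)\<^sup>2 + (norm v)\<^sup>2))"

definition S :: "real \<Rightarrow> kinetic_fun set" where
  "S \<beta> = {F. continuous_on ({0..} \<times> UNIV \<times> UNIV) (\<lambda>(t, x, v). F t x v) \<and>
            (\<exists>c>0. \<forall>t\<ge>0. \<forall>x v. \<bar>F t x v\<bar> \<le> c * exp (- \<beta> * ((norm x)\<^sup>2 + (norm v)\<^sup>2)))}"

text \<open>The real-valued suprema below are meaningful on \<open>S \<beta>\<close> and \<open>S_init \<beta>\<close>, where they are finite.\<close>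

definition S_norm :: "real \<Rightarrow> kinetic_fun \<Rightarrow> real" where
  "S_norm \<beta> F = (SUP (t, x, v) \<in> {0..} \<times> UNIV \<times> UNIV. weight \<beta> x v * \<bar>F t x v\<bar>)"

definition S_ball :: "real \<Rightarrow> real \<Rightarrow> kinetic_fun set" where
  "S_ball \<beta> R = {F \<in> S \<beta>. S_norm \<beta> F \<le> R}"

definition S_init :: "real \<Rightarrow> phase_fun set" where
  "S_init \<beta> = {F\<^sub>0. continuous_on UNIV (\<lambda>(x, v). F\<^sub>0 x v) \<and>
            (\<exists>c>0. \<forall>x v. \<bar>F\<^sub>0 x v\<bar> \<le> c * exp (- \<beta> * ((norm x)\<^sup>2 + (norm v)\<^sup>2)))}"

definition S_init_norm :: "real \<Rightarrow> phase_fun \<Rightarrow> real" where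
  "S_init_norm \<beta> F\<^sub>0 = (SUP (x, v). weight \<beta> x v * \<bar>F\<^sub>0 x v\<bar>)"


text \<open>
  Membership of a solution in \<open>S\<close> (and in the ball \<open>S_R\<close>) is understood for \<open>F\<close> read along the
  free-streaming characteristics, that is, for \<open>sharp F\<close>: this is the unknown of the mild equation.
  For \<open>F\<close> itself the bound would be incompatible with the equation.  The collision invariants give
  conservation of \<open>\<integral>\<integral> |v|\<^sup>2 F\<close> and of \<open>\<integral>\<integral> |x - t v|\<^sup>2 F\<close>; a bound
  \<open>|F| \<le> c exp (-\<beta> (|x|\<^sup>2 + |v|\<^sup>2))\<close> uniform in time would keep \<open>\<integral>\<integral> |x|\<^sup>2 F\<close> and
  \<open>\<integral>\<integral> x \<bullet> v F\<close> bounded, so that \<open>t\<^sup>2 \<integral>\<integral> |v|\<^sup>2 F\<^sub>0 = O(1 + t)\<close>, which forces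
  \<open>\<integral>\<integral> |v|\<^sup>2 F\<^sub>0 = 0\<close>.
\<close>
definition mild_solution :: "real \<Rightarrow> real \<Rightarrow> phase_fun \<Rightarrow> kinetic_fun \<Rightarrow> bool" where
  "mild_solution \<theta> \<beta> F\<^sub>0 F \<longleftrightarrow>
     sharp F \<in> S \<beta> \<and>
     (\<forall>t\<ge>0. \<forall>x v. sharp F t x v = F\<^sub>0 x v + (\<integral>\<tau>\<in>{0..t}. sharp (Q \<theta> F) \<tau> x v \<partial>lborel))"

end

theory Submission
  imports Defs "HOL-Probability.Distributions"
begin

text \<open>
  The mild equation is solved by Banach's fixed point theorem for \<open>F\<^sup>#\<close> in the ball of radius \<open>R\<close> of the
  Gaussian-weighted sup norm.  By conservation of energy, along characteristics both
  \<open>F(u') F(v')\<close> and \<open>F(u) F(v)\<close> are bounded by \<open>R\<^sup>2\<close> times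
  \<open>exp (-\<beta> (|x|\<^sup>2 + |v|\<^sup>2)) exp (-\<beta> (|u|\<^sup>2 + |x + \<tau> (v - u)|\<^sup>2))\<close>.  The factor \<open>|v - u|\<close> of the collision
  kernel is absorbed by integrating in time first: \<open>\<integral> |w| exp (-\<beta> |x + \<tau> w|\<^sup>2) d\<tau>\<close> is bounded uniformly in
  \<open>x\<close> and \<open>w\<close>.  Hence the Duhamel term is Lipschitz with a constant of order \<open>R\<close>.
\<close>


subsection \<open>Gaussian integrals and parameter integrals\<close>

text \<open>The majorant may depend on the point \<open>p\<close> and need only hold near it,
  because the majorants used below grow with the velocity and are only locally uniform. Continuity
  is checked along sequences by dominated convergence.\<close>

lemma continuous_on_integral_dominated:
  fixes f :: "'p::metric_space \<Rightarrow> 'a \<Rightarrow> real"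
  assumes meas: "\<And>p. f p \<in> borel_measurable M"
    and cont: "\<And>a. a \<in> space M \<Longrightarrow> continuous_on UNIV (\<lambda>p. f p a)"
    and dom: "\<And>p. \<exists>w. integrable M w \<and> (\<forall>\<^sub>F q in nhds p. \<forall>a\<in>space M. \<bar>f q a\<bar> \<le> w a)"
  shows "continuous_on UNIV (\<lambda>p. \<integral>a. f p a \<partial>M)"
proof -
  have "(\<lambda>n. \<integral>a. f (X n) a \<partial>M) \<longlonglongrightarrow> (\<integral>a. f p a \<partial>M)" if X: "X \<longlonglongrightarrow> p" for X :: "nat \<Rightarrow> 'p" and p
  proof -
    obtain w where w: "integrable M w" "\<forall>\<^sub>F q in nhds p. \<forall>a\<in>space M. \<bar>f q a\<bar> \<le> w a"
      using dom by blast
    from X w(2) have "\<forall>\<^sub>F n in sequentially. \<forall>a\<in>space M. \<bar>f (X n) a\<bar> \<le> w a"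
      unfolding filterlim_iff by blast
    then obtain N where N: "\<And>n. n \<ge> N \<Longrightarrow> \<forall>a\<in>space M. \<bar>f (X n) a\<bar> \<le> w a"
      by (auto simp: eventually_sequentially)
    show ?thesis
    \<comment> \<open>The majorant holds only from index \<open>N\<close> on, so the sequence is
      shifted by \<open>N\<close> before dominated convergence is applied.\<close>
    proof (rule LIMSEQ_offset[where k=N], rule integral_dominated_convergence[where w=w])
      show "AE a in M. (\<lambda>n. f (X (n + N)) a) \<longlonglongrightarrow> f p a"
      proof (rule AE_I2)
        fix a assume "a \<in> space M"
        from cont[OF this] have "isCont (\<lambda>p. f p a) p"
          by (simp add: continuous_on_eq_continuous_at)
        from isCont_tendsto_compose[OF this LIMSEQ_ignore_initial_segment[OF X]]
        show "(\<lambda>n. f (X (n + N)) a) \<longlonglongrightarrow> f p a" .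
      qed
    qed (use meas w N in auto)
  qed
  then show ?thesis
    by (auto simp: continuous_on_sequentially o_def)
qed

text \<open>The function is a multiple of the centred normal density with variance
  \<open>1 / (2 * \<beta>)\<close>.\<close>

lemma integrable_gaussian_real:
  assumes "\<beta> > 0"
  shows "integrable lborel (\<lambda>s::real. exp (- \<beta> * s\<^sup>2))"
proof -
  define \<sigma> where "\<sigma> = sqrt (1 / (2 * \<beta>))"
  have \<sigma>: "\<sigma> > 0" "\<sigma>\<^sup>2 = 1 / (2 * \<beta>)" using assms by (auto simp: \<sigma>_def)
  have "integrable lborel (\<lambda>s. sqrt (2 * pi * \<sigma>\<^sup>2) * normal_density 0 \<sigma> s)"
    using integrable_normal_moment[of \<sigma> 0 0] \<sigma>(1) by simp
  also have "(\<lambda>s. sqrt (2 * pi * \<sigma>\<^sup>2) * normal_density 0 \<sigma> s) = (\<lambda>s. exp (- \<beta> * s\<^sup>2))"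
    using \<sigma> assms by (auto simp: normal_density_def fun_eq_iff)
  finally show ?thesis .
qed

text \<open>The Gaussian is a product over the coordinates, so its integral is a power of the
  one-dimensional one.\<close>

lemma integrable_gaussian:
  assumes "\<beta> > 0"
  shows "integrable lborel (\<lambda>u::'a::euclidean_space. exp (- \<beta> * (norm u)\<^sup>2))"
proof (rule integrableI_nonneg)
  have norm2: "(norm u)\<^sup>2 = (\<Sum>b\<in>Basis. (u \<bullet> b)\<^sup>2)" for u :: 'a
    unfolding power2_norm_eq_inner by (subst euclidean_inner) (simp add: power2_eq_square)
  have "(\<integral>\<^sup>+(u::'a). ennreal (exp (- \<beta> * (norm u)\<^sup>2)) \<partial>lborel)
      = (\<integral>\<^sup>+(u::'a). (\<Prod>b\<in>Basis. ennreal (exp (- \<beta> * (u \<bullet> b)\<^sup>2))) \<partial>lborel)"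
    by (subst prod_ennreal)
       (simp_all add: norm2 sum_distrib_left exp_sum flip: sum_negf)
  also have "\<dots> = (\<Prod>b\<in>(Basis::'a set). (\<integral>\<^sup>+s. ennreal (exp (- \<beta> * s\<^sup>2)) \<partial>lborel))"
    by (rule nn_integral_lborel_prod[where f="\<lambda>b s. ennreal (exp (- \<beta> * s\<^sup>2))"]) auto
  also have "\<dots> < \<infinity>"
    using integrable_gaussian_real[OF assms]
    by (auto simp: integrable_iff_bounded power_less_top_ennreal)
  finally show "(\<integral>\<^sup>+(u::'a). ennreal (exp (- \<beta> * (norm u)\<^sup>2)) \<partial>lborel) < \<infinity>" .
qed auto

text \<open>Half of the exponent pays for the factor \<open>norm u\<close>. The constant comes from
  \<open>r \<le> 1 + r\<^sup>2 \<le> (1 + 2 / \<beta>) * (1 + \<beta> / 2 * r\<^sup>2)\<close>,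
  where the last factor is at most an exponential.\<close>

lemma integrable_norm_gaussian:
  assumes "\<beta> > 0"
  shows "integrable lborel (\<lambda>u::'a::euclidean_space. norm u * exp (- \<beta> * (norm u)\<^sup>2))"
proof (rule Bochner_Integration.integrable_bound)
  let ?c = "1 + 2 / \<beta>"
  show "integrable lborel (\<lambda>u::'a. ?c * exp (- (\<beta> / 2) * (norm u)\<^sup>2))"
    using integrable_gaussian[of "\<beta> / 2"] assms by (intro integrable_mult_right) auto
  have "norm u * exp (- \<beta> * (norm u)\<^sup>2) \<le> ?c * exp (- (\<beta> / 2) * (norm u)\<^sup>2)" for u :: 'a
  proof -
    define r where "r = norm u"
    have "2 * r \<le> 1 + r\<^sup>2" using sum_squares_bound[of r 1] by simp
    then have "r \<le> 1 + r\<^sup>2" using zero_le_power2[of r] by linarith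
    also have "\<dots> \<le> ?c * (1 + \<beta> / 2 * r\<^sup>2)"
      using assms by (simp add: field_simps)
    also have "\<dots> \<le> ?c * exp (\<beta> / 2 * r\<^sup>2)"
      using assms by (intro mult_left_mono exp_ge_add_one_self) auto
    finally have "r * exp (- \<beta> * r\<^sup>2) \<le> ?c * exp (\<beta> / 2 * r\<^sup>2) * exp (- \<beta> * r\<^sup>2)"
      by (intro mult_right_mono) auto
    also have "\<dots> = ?c * exp (- (\<beta> / 2) * r\<^sup>2)"
      by (simp flip: exp_add)
    finally show ?thesis by (simp add: r_def)
  qed
  then show "AE u::'a in lborel. norm (norm u * exp (- \<beta> * (norm u)\<^sup>2))
      \<le> norm (?c * exp (- (\<beta> / 2) * (norm u)\<^sup>2))"
    using assms by (intro AE_I2) (auto simp: abs_mult)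
qed measurable

text \<open>Only the component of \<open>x + \<tau> *\<^sub>R w\<close> along \<open>w\<close> is
  kept. The substitution \<open>s = a + norm w * \<tau>\<close> then consumes the factor
  \<open>norm w\<close> exactly, which makes the bound independent of \<open>x\<close> and
  \<open>w\<close>.\<close>

lemma nn_integral_gaussian_line_le:
  fixes x w :: "'a::euclidean_space"
  assumes "\<beta> > 0"
  shows "(\<integral>\<^sup>+\<tau>. ennreal (norm w * exp (- \<beta> * (norm (x + \<tau> *\<^sub>R w))\<^sup>2)) \<partial>lborel)
    \<le> (\<integral>\<^sup>+s. ennreal (exp (- \<beta> * s\<^sup>2)) \<partial>lborel)"
proof (cases "w = 0")
  case False
  define a where "a = x \<bullet> (w /\<^sub>R norm w)"
  have "\<bar>a + norm w * \<tau>\<bar> \<le> norm (x + \<tau> *\<^sub>R w)" for \<tau>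
  proof -
    have "a + norm w * \<tau> = (x + \<tau> *\<^sub>R w) \<bullet> (w /\<^sub>R norm w)"
      using False by (simp add: a_def inner_add_left dot_square_norm power2_eq_square field_simps)
    also have "\<bar>\<dots>\<bar> \<le> norm (x + \<tau> *\<^sub>R w) * norm (w /\<^sub>R norm w)"
      by (rule Cauchy_Schwarz_ineq2)
    finally show ?thesis using False by simp
  qed
  then have "(a + norm w * \<tau>)\<^sup>2 \<le> (norm (x + \<tau> *\<^sub>R w))\<^sup>2" for \<tau>
    by (metis abs_le_square_iff abs_norm_cancel)
  then have "(\<integral>\<^sup>+\<tau>. ennreal (norm w * exp (- \<beta> * (norm (x + \<tau> *\<^sub>R w))\<^sup>2)) \<partial>lborel)
      \<le> (\<integral>\<^sup>+\<tau>. ennreal (norm w * exp (- \<beta> * (a + norm w * \<tau>)\<^sup>2)) \<partial>lborel)"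
    using assms by (intro nn_integral_mono ennreal_leI mult_left_mono) auto
  also have "\<dots> = ennreal (norm w) * (\<integral>\<^sup>+\<tau>. ennreal (exp (- \<beta> * (a + norm w * \<tau>)\<^sup>2)) \<partial>lborel)"
    by (subst nn_integral_cmult[symmetric]) (auto simp: ennreal_mult)
  also have "\<dots> = (\<integral>\<^sup>+s. ennreal (exp (- \<beta> * s\<^sup>2)) \<partial>lborel)"
    using False
    by (subst nn_integral_real_affine[where c="norm w" and t=a and f="\<lambda>s. ennreal (exp (- \<beta> * s\<^sup>2))"])
       auto
  finally show ?thesis .
qed simp

subsection \<open>The collision kernel\<close>

definition gauss :: "real \<Rightarrow> vec3 \<Rightarrow> vec3 \<Rightarrow> real" where
  "gauss \<beta> x v = exp (- \<beta> * ((norm x)\<^sup>2 + (norm v)\<^sup>2))"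

lemma gauss_pos [simp]: "gauss \<beta> x v > 0" "gauss \<beta> x v \<ge> 0" "gauss \<beta> x v \<noteq> 0" "\<not> gauss \<beta> x v \<le> 0"
  by (auto simp: gauss_def)

lemma gauss_le_1: "\<beta> \<ge> 0 \<Longrightarrow> gauss \<beta> x v \<le> 1"
  by (simp add: gauss_def)

lemma gauss_le: "\<beta> \<ge> 0 \<Longrightarrow> gauss \<beta> x v \<le> exp (- \<beta> * (norm v)\<^sup>2)"
  by (simp add: gauss_def mult_left_mono)

lemma weight_eq: "weight \<beta> x v = 1 / gauss \<beta> x v"
  by (simp add: weight_def gauss_def exp_minus divide_inverse)

text \<open>
  Besides \<open>|u'|\<^sup>2 + |v'|\<^sup>2 = |u|\<^sup>2 + |v|\<^sup>2\<close>, the vectors \<open>v - u'\<close> and \<open>v - v'\<close> are the orthogonal components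
  of \<open>v - u\<close>; hence gain and loss terms obey the same Gaussian bound.
\<close>
lemma norm_post_identity:
  assumes "norm \<omega> = 1"
  shows "((norm (x + \<tau> *\<^sub>R (v - post_u \<omega> u v)))\<^sup>2 + (norm (post_u \<omega> u v))\<^sup>2)
       + ((norm (x + \<tau> *\<^sub>R (v - post_v \<omega> u v)))\<^sup>2 + (norm (post_v \<omega> u v))\<^sup>2)
       = ((norm (x + \<tau> *\<^sub>R (v - u)))\<^sup>2 + (norm u)\<^sup>2) + ((norm x)\<^sup>2 + (norm v)\<^sup>2)"
proof -
  \<comment> \<open>Both velocity jumps are multiples of the scalar \<open>s\<close>. After
    expansion into inner products the identity rests only on
    \<open>\<omega> \<bullet> \<omega> = 1\<close> and on the value of \<open>s\<close>.\<close>
  define s where "s = \<omega> \<bullet> (v - u)"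
  have w: "\<omega> \<bullet> \<omega> = 1" using assms by (simp add: dot_square_norm)
  have s: "\<omega> \<bullet> v = s + \<omega> \<bullet> u" by (simp add: s_def inner_diff_right)
  show ?thesis
    unfolding post_u_def post_v_def s_def[symmetric] power2_norm_eq_inner
    using w s
    by (simp add: inner_commute algebra_simps)
qed

lemma gauss_post:
  assumes "norm \<omega> = 1"
  shows "gauss \<beta> (x + \<tau> *\<^sub>R (v - post_u \<omega> u v)) (post_u \<omega> u v)
       * gauss \<beta> (x + \<tau> *\<^sub>R (v - post_v \<omega> u v)) (post_v \<omega> u v)
       = gauss \<beta> (x + \<tau> *\<^sub>R (v - u)) u * gauss \<beta> x v"
  unfolding gauss_def exp_add[symmetric] distrib_left[symmetric]
  using norm_post_identity[OF assms, of x \<tau> v u] by simp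

text \<open>Gain and loss terms share this shape, with the two pairs of velocities exchanged. The
  Gaussian factors \<open>e\<^sub>1\<close> and \<open>e\<^sub>2\<close> are tracked only for the
  product \<open>a * b\<close>; the statistical factors get the crude bounds \<open>R\<close> and
  \<open>\<delta>\<close>. Telescoping gives
  \<open>2 * R * \<delta> * (1 + 2 * R) + R\<^sup>2 * 2 * \<delta>\<close>, which is the stated
  constant.\<close>

lemma quantum_product_diff_le:
  fixes a b c d a' b' c' d' :: real
  assumes \<theta>: "\<bar>\<theta>\<bar> \<le> 1" and R: "R \<ge> 0" and \<delta>: "\<delta> \<ge> 0"
    and e: "e\<^sub>1 \<ge> 0" "e\<^sub>2 \<ge> 0"
    and b: "\<bar>a\<bar> \<le> R * e\<^sub>1" "\<bar>a'\<bar> \<le> R * e\<^sub>1" "\<bar>b\<bar> \<le> R * e\<^sub>2" "\<bar>b'\<bar> \<le> R * e\<^sub>2"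
      "\<bar>c\<bar> \<le> R" "\<bar>d\<bar> \<le> R"
    and d: "\<bar>a - a'\<bar> \<le> \<delta> * e\<^sub>1" "\<bar>b - b'\<bar> \<le> \<delta> * e\<^sub>2" "\<bar>c - c'\<bar> \<le> \<delta>" "\<bar>d - d'\<bar> \<le> \<delta>"
  shows "\<bar>a * b * (1 + \<theta> * c + \<theta> * d) - a' * b' * (1 + \<theta> * c' + \<theta> * d')\<bar>
    \<le> e\<^sub>1 * e\<^sub>2 * (\<delta> * (2 * R + 6 * R\<^sup>2))"
proof -
  have th: "\<bar>\<theta> * y\<bar> \<le> \<bar>y\<bar>" for y using \<theta> by (simp add: abs_mult mult_left_le_one_le)
  have "a * b - a' * b' = a * (b - b') + (a - a') * b'" by (simp add: algebra_simps)
  also have "\<bar>\<dots>\<bar> \<le> \<bar>a\<bar> * \<bar>b - b'\<bar> + \<bar>a - a'\<bar> * \<bar>b'\<bar>"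
    by (metis abs_mult abs_triangle_ineq)
  also have "\<dots> \<le> (R * e\<^sub>1) * (\<delta> * e\<^sub>2) + (\<delta> * e\<^sub>1) * (R * e\<^sub>2)"
    using R \<delta> e by (intro add_mono mult_mono b d) auto
  finally have 1: "\<bar>a * b - a' * b'\<bar> \<le> e\<^sub>1 * e\<^sub>2 * (2 * R * \<delta>)" by (simp add: algebra_simps)
  have 2: "\<bar>1 + \<theta> * c + \<theta> * d\<bar> \<le> 1 + 2 * R"
    using th[of c] th[of d] b by linarith
  have "\<bar>a' * b'\<bar> \<le> (R * e\<^sub>1) * (R * e\<^sub>2)"
    unfolding abs_mult using R \<delta> e by (intro mult_mono b d) auto
  then have 3: "\<bar>a' * b'\<bar> \<le> e\<^sub>1 * e\<^sub>2 * R\<^sup>2" by (simp add: power2_eq_square algebra_simps)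
  have 4: "\<bar>\<theta> * (c - c') + \<theta> * (d - d')\<bar> \<le> 2 * \<delta>"
    using th[of "c - c'"] th[of "d - d'"] d by linarith
  have "a * b * (1 + \<theta> * c + \<theta> * d) - a' * b' * (1 + \<theta> * c' + \<theta> * d')
      = (a * b - a' * b') * (1 + \<theta> * c + \<theta> * d) + (a' * b') * (\<theta> * (c - c') + \<theta> * (d - d'))"
    by (simp add: algebra_simps)
  also have "\<bar>\<dots>\<bar> \<le> \<bar>a * b - a' * b'\<bar> * \<bar>1 + \<theta> * c + \<theta> * d\<bar> + \<bar>a' * b'\<bar> * \<bar>\<theta> * (c - c') + \<theta> * (d - d')\<bar>"
    by (metis abs_mult abs_triangle_ineq)
  also have "\<dots> \<le> (e\<^sub>1 * e\<^sub>2 * (2 * R * \<delta>)) * (1 + 2 * R) + (e\<^sub>1 * e\<^sub>2 * R\<^sup>2) * (2 * \<delta>)"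
    using R \<delta> e by (intro add_mono mult_mono 1 2 3 4) auto
  also have "\<dots> = e\<^sub>1 * e\<^sub>2 * (\<delta> * (2 * R + 6 * R\<^sup>2))"
    by (simp add: algebra_simps power2_eq_square)
  finally show ?thesis .
qed

section \<open>Measurability and total mass on the unit sphere\<close>

lemma borel_measurable_sphere_measure:
  fixes f :: "'a::euclidean_space \<Rightarrow> real"
  assumes "continuous_on UNIV f"
  shows "f \<in> borel_measurable sphere_measure"
proof -
  have "f \<in> borel_measurable (restrict_space borel (sphere 0 1))"
    using assms by (intro measurable_restrict_space1 borel_measurable_continuous_onI)
  moreover have "sets sphere_measure = sets (restrict_space borel (sphere (0::'a) 1))"
    by (simp add: sphere_measure_def)
  ultimately show ?thesis using measurable_cong_sets by blast
qed

lemma finite_measure_sphere: "finite_measure (sphere_measure :: vec3 measure)"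
  by (rule finite_measureI) (simp add: emeasure_sphere_measure_space)

lemma measure_sphere: "measure (sphere_measure :: vec3 measure) (sphere 0 1) = 4 * pi"
  by (simp add: measure_def emeasure_sphere_measure_space)

section \<open>Pointwise estimates and continuity of the collision integrand\<close>

definition collision_kernel :: "real \<Rightarrow> (vec3 \<Rightarrow> real) \<Rightarrow> vec3 \<Rightarrow> vec3 \<Rightarrow> vec3 \<Rightarrow> real" where
  "collision_kernel \<theta> f v u \<omega> = \<bar>\<omega> \<bullet> (v - u)\<bar> *
         (f (post_u \<omega> u v) * f (post_v \<omega> u v) * (1 + \<theta> * f u + \<theta> * f v)
          - f u * f v * (1 + \<theta> * f (post_u \<omega> u v) + \<theta> * f (post_v \<omega> u v)))"

text \<open>
  If \<open>K\<close> represents \<open>F\<^sup>#\<close>, then \<open>along K (t, x, v)\<close> is the velocity profile \<open>F(t, x + t v, \<cdot>)\<close>.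
\<close>
definition along :: "(real \<times> vec3 \<times> vec3 \<Rightarrow> real) \<Rightarrow> real \<times> vec3 \<times> vec3 \<Rightarrow> vec3 \<Rightarrow> real" where
  "along K = (\<lambda>(t, x, v) w. K (t, x + t *\<^sub>R (v - w), w))"

text \<open>This is the ball of radius \<open>R\<close> for functions standing for
  \<open>sharp F\<close>, but with all real times allowed. Functions given only for nonnegative
  times enter it by freezing them at time 0.\<close>

definition dominated :: "real \<Rightarrow> real \<Rightarrow> (real \<times> vec3 \<times> vec3 \<Rightarrow> real) \<Rightarrow> bool" where
  "dominated \<beta> R K \<longleftrightarrow> continuous_on UNIV K \<and> (\<forall>t x v. \<bar>K (t, x, v)\<bar> \<le> R * gauss \<beta> x v)"

lemma dominated_nonneg:
  assumes "dominated \<beta> R K"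
  shows "R \<ge> 0"
proof -
  have "0 \<le> R * gauss \<beta> 0 0"
    using assms unfolding dominated_def by (meson abs_ge_zero order_trans)
  then show ?thesis by (simp add: zero_le_mult_iff)
qed

text \<open>Comparison with the zero function, taking \<open>\<delta> = R\<close>, turns each
  Lipschitz estimate below into a size estimate.\<close>

lemma dominated_zero: "R \<ge> 0 \<Longrightarrow> dominated \<beta> R (\<lambda>_. 0)"
  by (simp add: dominated_def)

text \<open>Twice the polynomial \<open>2 * R + 6 * R\<^sup>2\<close> of
  \<open>quantum_product_diff_le\<close>: one share for the gain and one for the loss.\<close>

definition lip_const :: "real \<Rightarrow> real" where
  "lip_const R = 4 * R + 12 * R\<^sup>2"

text \<open>Gain and loss are estimated separately by \<open>quantum_product_diff_le\<close>, and
  \<open>gauss_post\<close> gives both the same Gaussian product \<open>g u * g v\<close>. At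
  \<open>w = v\<close> the shift along the characteristic vanishes, so \<open>g v\<close> is exactly
  the weight \<open>gauss \<beta> x v\<close> that the norm requires.\<close>

lemma collision_kernel_diff_le:
  assumes \<theta>: "\<bar>\<theta>\<bar> \<le> 1" and \<beta>: "\<beta> \<ge> 0" and K: "dominated \<beta> R K" and L: "dominated \<beta> R L"
    and KL: "\<And>t x v. \<bar>K (t, x, v) - L (t, x, v)\<bar> \<le> \<delta> * gauss \<beta> x v"
    and \<omega>: "norm \<omega> = 1"
  shows "\<bar>collision_kernel \<theta> (along K (t, x, v)) v u \<omega> - collision_kernel \<theta> (along L (t, x, v)) v u \<omega>\<bar>
    \<le> \<delta> * lip_const R * gauss \<beta> x v * (norm (v - u) * gauss \<beta> (x + t *\<^sub>R (v - u)) u)"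
proof -
  define g where "g w = gauss \<beta> (x + t *\<^sub>R (v - w)) w" for w
  define f where "f = along K (t, x, v)"
  define h where "h = along L (t, x, v)"
  define u' where "u' = post_u \<omega> u v"
  define v' where "v' = post_v \<omega> u v"
  have R: "R \<ge> 0" using dominated_nonneg[OF K] .
  \<comment> \<open>The closeness hypothesis at a single point already forces
    \<open>\<delta>\<close> to be nonnegative.\<close>
  have "0 \<le> \<delta> * gauss \<beta> 0 0"
    using KL[of 0 0 0] by linarith
  then have \<delta>: "\<delta> \<ge> 0" by (simp add: zero_le_mult_iff)
  have g: "g w \<ge> 0" "g w \<le> 1" for w using \<beta> by (auto simp: g_def gauss_le_1)
  have f: "\<bar>f w\<bar> \<le> R * g w" "\<bar>h w\<bar> \<le> R * g w" "\<bar>f w - h w\<bar> \<le> \<delta> * g w" for w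
    using K L KL by (auto simp: dominated_def f_def h_def g_def along_def)
  have f1: "\<bar>f w\<bar> \<le> R" "\<bar>f w - h w\<bar> \<le> \<delta>" for w
    using f[of w] mult_left_mono[OF g(2) R, of w] mult_left_mono[OF g(2) \<delta>, of w] by auto
  have E: "g u' * g v' = g u * g v"
    using gauss_post[OF \<omega>, of \<beta> x t v u] by (simp add: g_def u'_def v'_def)
  define A where "A f = f u' * f v' * (1 + \<theta> * f u + \<theta> * f v)" for f :: "vec3 \<Rightarrow> real"
  define B where "B f = f u * f v * (1 + \<theta> * f u' + \<theta> * f v')" for f :: "vec3 \<Rightarrow> real"
  have "\<bar>A f - A h\<bar> \<le> g u' * g v' * (\<delta> * (2 * R + 6 * R\<^sup>2))"
    unfolding A_def by (rule quantum_product_diff_le) (intro \<theta> R \<delta> g f f1)+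
  moreover have "\<bar>B f - B h\<bar> \<le> g u * g v * (\<delta> * (2 * R + 6 * R\<^sup>2))"
    unfolding B_def by (rule quantum_product_diff_le) (intro \<theta> R \<delta> g f f1)+
  ultimately have "\<bar>(A f - B f) - (A h - B h)\<bar> \<le> 2 * (g u * g v * (\<delta> * (2 * R + 6 * R\<^sup>2)))"
    unfolding E by linarith
  also have "\<dots> = g u * g v * (\<delta> * lip_const R)" by (simp add: lip_const_def algebra_simps)
  finally have AB: "\<bar>(A f - B f) - (A h - B h)\<bar> \<le> g u * g v * (\<delta> * lip_const R)" .
  have "\<bar>\<omega> \<bullet> (v - u)\<bar> \<le> norm (v - u)"
    using Cauchy_Schwarz_ineq2[of \<omega> "v - u"] \<omega> by simp
  then have "\<bar>\<omega> \<bullet> (v - u)\<bar> * \<bar>(A f - B f) - (A h - B h)\<bar>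
      \<le> norm (v - u) * (g u * g v * (\<delta> * lip_const R))"
    by (intro mult_mono AB) auto
  moreover have "collision_kernel \<theta> f v u \<omega> - collision_kernel \<theta> h v u \<omega>
      = \<bar>\<omega> \<bullet> (v - u)\<bar> * ((A f - B f) - (A h - B h))"
    by (simp add: collision_kernel_def A_def B_def u'_def v'_def right_diff_distrib)
  moreover have "g v = gauss \<beta> x v" by (simp add: g_def)
  ultimately show ?thesis
    by (simp add: abs_mult f_def[symmetric] h_def[symmetric] g_def[symmetric] ac_simps)
qed

lemma lip_const_nonneg: "R \<ge> 0 \<Longrightarrow> lip_const R \<ge> 0"
  by (simp add: lip_const_def)

lemma collision_kernel_zero: "collision_kernel \<theta> (along (\<lambda>_. 0) p) v u \<omega> = 0"
  by (simp add: collision_kernel_def along_def split: prod.split)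

lemma collision_kernel_le:
  assumes "\<bar>\<theta>\<bar> \<le> 1" "\<beta> \<ge> 0" "dominated \<beta> R K" "norm \<omega> = 1"
  shows "\<bar>collision_kernel \<theta> (along K (t, x, v)) v u \<omega>\<bar>
    \<le> R * lip_const R * gauss \<beta> x v * (norm (v - u) * gauss \<beta> (x + t *\<^sub>R (v - u)) u)"
  using collision_kernel_diff_le[OF assms(1-3) dominated_zero[OF dominated_nonneg[OF assms(3)]] _ assms(4), of R t x v u]
    assms(3)
  by (simp add: collision_kernel_zero dominated_def)

text \<open>Dropping the Gaussian in \<open>(x, v)\<close> and the spatial part of the other one
  leaves a bound free of \<open>t\<close> and \<open>x\<close>. It serves for integrability and
  domination, while \<open>collision_kernel_diff_le\<close> keeps the decay needed for the
  norm.\<close>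

lemma collision_kernel_le':
  assumes "\<bar>\<theta>\<bar> \<le> 1" "\<beta> \<ge> 0" "dominated \<beta> R K" "norm \<omega> = 1"
  shows "\<bar>collision_kernel \<theta> (along K (t, x, v)) v u \<omega>\<bar>
    \<le> R * lip_const R * (norm (v - u) * exp (- \<beta> * (norm u)\<^sup>2))"
proof -
  have R: "R \<ge> 0" using dominated_nonneg[OF assms(3)] .
  have "R * lip_const R * gauss \<beta> x v * (norm (v - u) * gauss \<beta> (x + t *\<^sub>R (v - u)) u)
      \<le> R * lip_const R * 1 * (norm (v - u) * exp (- \<beta> * (norm u)\<^sup>2))"
    using assms(2) R lip_const_nonneg[OF R]
    by (intro mult_mono gauss_le gauss_le_1 mult_left_mono) auto
  then show ?thesis using collision_kernel_le[OF assms, of t x v u] by simp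
qed

text \<open>All parameters are allowed to move, so that this covers both continuity in
  \<open>\<omega>\<close> alone and joint continuity in the phase point and
  \<open>u\<close>.\<close>

lemma continuous_on_collision_kernel:
  assumes K: "continuous_on UNIV K"
    and [continuous_intros]: "continuous_on A p" "continuous_on A u" "continuous_on A \<omega>"
  shows "continuous_on A (\<lambda>z. collision_kernel \<theta> (along K (p z)) (snd (snd (p z))) (u z) (\<omega> z))"
  unfolding collision_kernel_def along_def post_u_def post_v_def case_prod_beta
  by (intro continuous_intros continuous_on_compose2[OF K _ subset_UNIV])

subsection \<open>The collision operator along characteristics\<close>

definition sphere_integral :: "real \<Rightarrow> (real \<times> vec3 \<times> vec3 \<Rightarrow> real) \<Rightarrow> real \<times> vec3 \<times> vec3 \<Rightarrow> vec3 \<Rightarrow> real" where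
  "sphere_integral \<theta> K p u = (\<integral>\<omega>. collision_kernel \<theta> (along K p) (snd (snd p)) u \<omega> \<partial>sphere_measure)"

lemma borel_measurable_collision_kernel:
  assumes "dominated \<beta> R K"
  shows "(\<lambda>\<omega>. collision_kernel \<theta> (along K p) (snd (snd p)) u \<omega>) \<in> borel_measurable sphere_measure"
  using assms unfolding dominated_def
  by (intro borel_measurable_sphere_measure continuous_on_collision_kernel continuous_intros) auto

lemma integrable_collision_kernel:
  assumes "\<bar>\<theta>\<bar> \<le> 1" "\<beta> \<ge> 0" "dominated \<beta> R K"
  shows "integrable sphere_measure (\<lambda>\<omega>. collision_kernel \<theta> (along K p) (snd (snd p)) u \<omega>)"
proof -
  obtain t x v where p: "p = (t, x, v)" by (cases p)
  show ?thesis
    using collision_kernel_le'[OF assms, of _ t x v u]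
    by (intro finite_measure.integrable_const_bound[OF finite_measure_sphere _
          borel_measurable_collision_kernel[OF assms(3)]] AE_I2)
       (auto simp: p)
qed

lemma continuous_on_sphere_integral_pair:
  assumes "\<bar>\<theta>\<bar> \<le> 1" "\<beta> \<ge> 0" and K: "dominated \<beta> R K"
  shows "continuous_on UNIV (\<lambda>(p, u). sphere_integral \<theta> K p u)"
  unfolding sphere_integral_def case_prod_beta
proof (rule continuous_on_integral_dominated)
  fix q :: "(real \<times> vec3 \<times> vec3) \<times> vec3"
  show "(\<lambda>\<omega>. collision_kernel \<theta> (along K (fst q)) (snd (snd (fst q))) (snd q) \<omega>) \<in> borel_measurable sphere_measure"
    by (rule borel_measurable_collision_kernel[OF K])
next
  fix \<omega> :: vec3
  show "continuous_on UNIV (\<lambda>q. collision_kernel \<theta> (along K (fst q)) (snd (snd (fst q))) (snd q) \<omega>)"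
    using K unfolding dominated_def
    by (intro continuous_on_collision_kernel continuous_intros) auto
next
  fix q :: "(real \<times> vec3 \<times> vec3) \<times> vec3"
  let ?d = "\<lambda>q :: (real \<times> vec3 \<times> vec3) \<times> vec3. norm (snd (snd (fst q)) - snd q)"
  \<comment> \<open>Near \<open>q\<close> the relative speed stays below its value at
    \<open>q\<close> plus one. A constant majorant suffices because the sphere has finite
    measure.\<close>
  let ?c = "R * lip_const R * (?d q + 1)"
  have R: "R \<ge> 0" using dominated_nonneg[OF K] .
  have "(?d \<longlongrightarrow> ?d q) (nhds q)" by (intro tendsto_intros filterlim_ident)
  then have "\<forall>\<^sub>F q' in nhds q. ?d q' < ?d q + 1" by (rule order_tendstoD) simp
  then have "\<forall>\<^sub>F q' in nhds q. \<forall>\<omega>\<in>space sphere_measure.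
      \<bar>collision_kernel \<theta> (along K (fst q')) (snd (snd (fst q'))) (snd q') \<omega>\<bar> \<le> ?c"
  proof eventually_elim
    case (elim q')
    obtain t x v u where q': "q' = ((t, x, v), u)" by (cases q') auto
    have "R * lip_const R * (norm (v - u) * exp (- \<beta> * (norm u)\<^sup>2)) \<le> R * lip_const R * ((?d q + 1) * 1)"
      using elim R lip_const_nonneg[OF R] assms(2) by (intro mult_left_mono mult_mono) (auto simp: q')
    from order_trans[OF collision_kernel_le'[OF assms] this, of _ t x]
    show ?case by (simp add: q')
  qed
  then show "\<exists>w. integrable sphere_measure w \<and> (\<forall>\<^sub>F q' in nhds q. \<forall>\<omega>\<in>space sphere_measure.
      \<bar>collision_kernel \<theta> (along K (fst q')) (snd (snd (fst q'))) (snd q') \<omega>\<bar> \<le> w \<omega>)"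
    by (intro exI[of _ "\<lambda>_. ?c"] conjI finite_measure.integrable_const finite_measure_sphere)
qed

lemma continuous_on_sphere_integral:
  assumes "\<bar>\<theta>\<bar> \<le> 1" "\<beta> \<ge> 0" "dominated \<beta> R K" "continuous_on A p" "continuous_on A u"
  shows "continuous_on A (\<lambda>z. sphere_integral \<theta> K (p z) (u z))"
proof -
  have "continuous_on A (\<lambda>z. (\<lambda>(p, u). sphere_integral \<theta> K p u) (p z, u z))"
    by (rule continuous_on_compose2[OF continuous_on_sphere_integral_pair[OF assms(1-3)]])
       (intro continuous_intros assms subset_UNIV)+
  then show ?thesis by simp
qed

lemma sphere_integral_diff_le:
  assumes "\<bar>\<theta>\<bar> \<le> 1" "\<beta> \<ge> 0" "dominated \<beta> R K" "dominated \<beta> R L"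
    and "\<And>t x v. \<bar>K (t, x, v) - L (t, x, v)\<bar> \<le> \<delta> * gauss \<beta> x v"
  shows "\<bar>sphere_integral \<theta> K (t, x, v) u - sphere_integral \<theta> L (t, x, v) u\<bar>
    \<le> 4 * pi * (\<delta> * lip_const R * gauss \<beta> x v * (norm (v - u) * gauss \<beta> (x + t *\<^sub>R (v - u)) u))"
    (is "_ \<le> 4 * pi * ?c")
proof -
  let ?k = "\<lambda>K \<omega>. collision_kernel \<theta> (along K (t, x, v)) v u \<omega>"
  have int: "integrable sphere_measure (?k K)" if "dominated \<beta> R K" for K
    using integrable_collision_kernel[OF assms(1,2) that, of "(t, x, v)" u] by simp
  have diff: "sphere_integral \<theta> K (t, x, v) u - sphere_integral \<theta> L (t, x, v) u
      = (\<integral>\<omega>. ?k K \<omega> - ?k L \<omega> \<partial>sphere_measure)"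
    unfolding sphere_integral_def snd_conv
    by (rule Bochner_Integration.integral_diff[OF int[OF assms(3)] int[OF assms(4)], symmetric])
  have "\<bar>\<integral>\<omega>. ?k K \<omega> - ?k L \<omega> \<partial>sphere_measure\<bar> \<le> (\<integral>\<omega>. \<bar>?k K \<omega> - ?k L \<omega>\<bar> \<partial>sphere_measure)"
    by (rule integral_abs_bound)
  also have "\<dots> \<le> (\<integral>\<omega>. ?c \<partial>(sphere_measure :: vec3 measure))"
  proof (rule integral_mono)
    show "integrable sphere_measure (\<lambda>\<omega>. \<bar>?k K \<omega> - ?k L \<omega>\<bar>)"
      by (intro integrable_abs Bochner_Integration.integrable_diff int assms)
    show "integrable (sphere_measure :: vec3 measure) (\<lambda>\<omega>. ?c)"
      by (rule finite_measure.integrable_const[OF finite_measure_sphere])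
    show "\<bar>?k K \<omega> - ?k L \<omega>\<bar> \<le> ?c" if "\<omega> \<in> space sphere_measure" for \<omega>
      using that by (intro collision_kernel_diff_le assms) simp
  qed
  also have "\<dots> = 4 * pi * ?c"
    by (simp add: measure_sphere)
  finally show ?thesis unfolding diff .
qed

lemma sphere_integral_zero: "sphere_integral \<theta> (\<lambda>_. 0) p u = 0"
  by (simp add: sphere_integral_def collision_kernel_zero)

lemma sphere_integral_le:
  assumes "\<bar>\<theta>\<bar> \<le> 1" "\<beta> \<ge> 0" "dominated \<beta> R K"
  shows "\<bar>sphere_integral \<theta> K (t, x, v) u\<bar>
    \<le> 4 * pi * (R * lip_const R * (norm (v - u) * exp (- \<beta> * (norm u)\<^sup>2)))"
proof -
  have R: "R \<ge> 0" using dominated_nonneg[OF assms(3)] .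
  have "\<bar>sphere_integral \<theta> K (t, x, v) u\<bar>
      \<le> 4 * pi * (R * lip_const R * gauss \<beta> x v * (norm (v - u) * gauss \<beta> (x + t *\<^sub>R (v - u)) u))"
    using sphere_integral_diff_le[OF assms dominated_zero[OF R], of R t x v u] assms(3)
    by (simp add: sphere_integral_zero dominated_def)
  also have "\<dots> \<le> 4 * pi * (R * lip_const R * 1 * (norm (v - u) * exp (- \<beta> * (norm u)\<^sup>2)))"
    using assms(2) R lip_const_nonneg[OF R]
    by (intro mult_mono gauss_le gauss_le_1 mult_left_mono) auto
  finally show ?thesis by simp
qed

lemma integrable_shifted_norm_gaussian:
  assumes "\<beta> > 0"
  shows "integrable lborel (\<lambda>u::'a::euclidean_space. (a + norm u) * exp (- \<beta> * (norm u)\<^sup>2))"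
  unfolding distrib_right
  by (intro Bochner_Integration.integrable_add integrable_mult_right
      integrable_gaussian integrable_norm_gaussian assms)

lemma borel_measurable_sphere_integral:
  assumes "\<bar>\<theta>\<bar> \<le> 1" "\<beta> \<ge> 0" "dominated \<beta> R K"
  shows "sphere_integral \<theta> K p \<in> borel_measurable lborel"
  using continuous_on_sphere_integral[OF assms continuous_on_const continuous_on_id, of UNIV p]
  by (auto dest: borel_measurable_continuous_onI)

text \<open>Replacing \<open>norm (v - u)\<close> by \<open>a + norm u\<close> gives one integrable
  function of \<open>u\<close> that works for all velocities of norm at most \<open>a\<close>, as
  local domination requires.\<close>

lemma sphere_integral_le_shifted:
  assumes "\<bar>\<theta>\<bar> \<le> 1" "\<beta> \<ge> 0" "dominated \<beta> R K" "norm (snd (snd p)) \<le> a"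
  shows "\<bar>sphere_integral \<theta> K p u\<bar>
    \<le> 4 * pi * (R * lip_const R) * ((a + norm u) * exp (- \<beta> * (norm u)\<^sup>2))"
proof -
  obtain t x v where p: "p = (t, x, v)" by (cases p)
  have R: "R \<ge> 0" using dominated_nonneg[OF assms(3)] .
  have "norm (v - u) \<le> a + norm u"
    using norm_triangle_ineq4[of v u] assms(4) by (simp add: p)
  then have "4 * pi * (R * lip_const R * (norm (v - u) * exp (- \<beta> * (norm u)\<^sup>2)))
      \<le> 4 * pi * (R * lip_const R * ((a + norm u) * exp (- \<beta> * (norm u)\<^sup>2)))"
    using R lip_const_nonneg[OF R] by (intro mult_left_mono mult_right_mono) auto
  from order_trans[OF sphere_integral_le[OF assms(1-3)] this, of t x]
  show ?thesis by (simp add: p mult.assoc)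
qed

lemma integrable_sphere_integral:
  assumes "\<bar>\<theta>\<bar> \<le> 1" "\<beta> > 0" "dominated \<beta> R K"
  shows "integrable lborel (sphere_integral \<theta> K p)"
proof (rule Bochner_Integration.integrable_bound)
  let ?w = "\<lambda>u. 4 * pi * (R * lip_const R) * ((norm (snd (snd p)) + norm u) * exp (- \<beta> * (norm u)\<^sup>2))"
  show "integrable lborel ?w"
    by (intro integrable_mult_right integrable_shifted_norm_gaussian assms)
  show "AE u in lborel. norm (sphere_integral \<theta> K p u) \<le> norm (?w u)"
    using sphere_integral_le_shifted[OF assms(1) _ assms(3) order_refl, of p] assms(2)
    by (intro AE_I2) (simp add: order_trans[OF _ abs_ge_self])
  show "sphere_integral \<theta> K p \<in> borel_measurable lborel"
    using borel_measurable_sphere_integral[OF assms(1) _ assms(3)] assms(2) by simp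
qed

text \<open>When \<open>K\<close> represents \<open>sharp F\<close>, this is
  \<open>sharp (Q \<theta> F)\<close>; see \<open>collision_along_sharp\<close>.\<close>

definition collision_along :: "real \<Rightarrow> (real \<times> vec3 \<times> vec3 \<Rightarrow> real) \<Rightarrow> real \<times> vec3 \<times> vec3 \<Rightarrow> real" where
  "collision_along \<theta> K p = collision \<theta> (along K p) (snd (snd p))"

lemma collision_along_eq: "collision_along \<theta> K p = (\<integral>u. sphere_integral \<theta> K p u \<partial>lborel)"
  by (simp add: collision_along_def collision_def sphere_integral_def collision_kernel_def)

lemma continuous_on_collision_along:
  assumes "\<bar>\<theta>\<bar> \<le> 1" "\<beta> > 0" "dominated \<beta> R K"
  shows "continuous_on UNIV (collision_along \<theta> K)"
  unfolding collision_along_eq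
proof (rule continuous_on_integral_dominated)
  have \<beta>: "\<beta> \<ge> 0" using assms by simp
  show "sphere_integral \<theta> K p \<in> borel_measurable lborel" for p
    by (rule borel_measurable_sphere_integral[OF assms(1) \<beta> assms(3)])
  show "continuous_on UNIV (\<lambda>p. sphere_integral \<theta> K p u)" for u
    by (intro continuous_on_sphere_integral[OF assms(1) \<beta> assms(3)] continuous_intros)
  fix p :: "real \<times> vec3 \<times> vec3"
  \<comment> \<open>The extra one keeps the velocity norm below \<open>a\<close> on a whole
    neighbourhood of \<open>p\<close>.\<close>
  define a where "a = norm (snd (snd p)) + 1"
  have "((\<lambda>q. norm (snd (snd q))) \<longlongrightarrow> norm (snd (snd p))) (nhds p)"
    by (intro tendsto_intros filterlim_ident)
  then have "\<forall>\<^sub>F q in nhds p. norm (snd (snd q)) < a"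
    by (rule order_tendstoD) (simp add: a_def)
  then have "\<forall>\<^sub>F q in nhds p. \<forall>u\<in>space lborel. \<bar>sphere_integral \<theta> K q u\<bar>
      \<le> 4 * pi * (R * lip_const R) * ((a + norm u) * exp (- \<beta> * (norm u)\<^sup>2))"
  proof eventually_elim
    case (elim q)
    then show ?case
      by (intro ballI sphere_integral_le_shifted[OF assms(1) \<beta> assms(3)] less_imp_le)
  qed
  moreover have "integrable lborel (\<lambda>u::vec3. 4 * pi * (R * lip_const R) * ((a + norm u) * exp (- \<beta> * (norm u)\<^sup>2)))"
    by (intro integrable_mult_right integrable_shifted_norm_gaussian assms)
  ultimately show "\<exists>w. integrable lborel w \<and> (\<forall>\<^sub>F q in nhds p. \<forall>u\<in>space lborel. \<bar>sphere_integral \<theta> K q u\<bar> \<le> w u)"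
    by blast
qed

lemma continuous_on_time_integral:
  fixes q :: "real \<times> 'a::metric_space \<Rightarrow> real"
  assumes q: "continuous_on UNIV q"
  shows "continuous_on UNIV (\<lambda>(t, y). \<integral>\<tau>\<in>{0..max t 0}. q (\<tau>, y) \<partial>lborel)"
proof -
  \<comment> \<open>The substitution \<open>\<tau> = s T\<close> moves the parameter from the domain of integration into the integrand.\<close>
  have cont: "continuous_on UNIV (\<lambda>z. integral (cbox 0 1) (\<lambda>s. max (fst z) 0 * q (s * max (fst z) 0, snd z)))"
    by (rule integral_continuous_on_param)
       (unfold case_prod_beta, intro continuous_intros continuous_on_compose2[OF q _ subset_UNIV])
  have "(\<integral>\<tau>\<in>{0..T}. q (\<tau>, y) \<partial>lborel) = integral (cbox 0 1) (\<lambda>s. T * q (s * T, y))" if "T \<ge> 0" for T y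
  proof -
    have "set_integrable lborel {0..1} (\<lambda>s. T * q (s * T, y))"
      by (intro borel_integrable_atLeastAtMost' continuous_intros continuous_on_compose2[OF q _ subset_UNIV])
    from set_borel_integral_eq_integral(2)[OF this]
    have 1: "integral (cbox 0 1) (\<lambda>s. T * q (s * T, y)) = (\<integral>s\<in>{0..1}. T * q (s * T, y) \<partial>lborel)"
      by (simp only: cbox_interval)
    show ?thesis
    proof (cases "T = 0")
      \<comment> \<open>The substitution degenerates at \<open>T = 0\<close>. Both sides are then 0:
        the left domain is a null set, and the right integrand carries the factor
        \<open>T\<close>.\<close>
      case True
      have "AE \<tau> in lborel. indicator {0..0::real} \<tau> *\<^sub>R q (\<tau>, y) = 0"
        using AE_lborel_singleton[of "0::real"] by eventually_elim simp
      then have "(\<integral>\<tau>\<in>{0..0::real}. q (\<tau>, y) \<partial>lborel) = 0"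
        unfolding set_lebesgue_integral_def by (rule integral_eq_zero_AE)
      then show ?thesis using True by simp
    next
      case False
      with that have "T > 0" by simp
      then have ind: "indicator {0..T} (0 + T * s) = (indicator {0..1} s :: real)" for s
        by (auto simp: indicator_def zero_le_mult_iff)
      show ?thesis
        unfolding 1 set_lebesgue_integral_def using \<open>T > 0\<close>
        by (subst lborel_integral_real_affine[where c=T and t=0])
           (simp_all only: ind, simp_all add: mult.commute mult.left_commute)
    qed
  qed
  then have "(\<lambda>(t, y). \<integral>\<tau>\<in>{0..max t 0}. q (\<tau>, y) \<partial>lborel)
      = (\<lambda>z. integral (cbox 0 1) (\<lambda>s. max (fst z) 0 * q (s * max (fst z) 0, snd z)))"
    by (auto simp: fun_eq_iff)
  then show ?thesis using cont by simp
qed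

subsection \<open>The Duhamel term\<close>

text \<open>The factors come from the area of the sphere, the time integral along a line, and the
  remaining Gaussian in \<open>u\<close>.\<close>

definition dispersion_const :: "real \<Rightarrow> real" where
  "dispersion_const \<beta> = 4 * pi * ((\<integral>s. exp (- \<beta> * s\<^sup>2) \<partial>lborel) * (\<integral>u. exp (- \<beta> * (norm u)\<^sup>2) \<partial>(lborel :: vec3 measure)))"

lemma dispersion_const_nonneg: "dispersion_const \<beta> \<ge> 0"
  by (simp add: dispersion_const_def)

text \<open>Tonelli puts the time integral inside. For fixed \<open>u\<close> it is the line
  integral with direction \<open>w = v - u\<close>, which removes the unbounded factor
  \<open>norm (v - u)\<close>. Integrating over all real times makes the bound uniform in
  time.\<close>

lemma nn_integral_dispersion_le:
  assumes "\<beta> > 0"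
  shows "(\<integral>\<^sup>+\<tau>. (\<integral>\<^sup>+u. ennreal (4 * pi * (norm (v - u) * gauss \<beta> (x + \<tau> *\<^sub>R (v - u)) u)) \<partial>lborel) \<partial>lborel)
    \<le> ennreal (dispersion_const \<beta>)"
proof -
  let ?k = "\<lambda>\<tau> (u :: vec3). ennreal (4 * pi * (norm (v - u) * gauss \<beta> (x + \<tau> *\<^sub>R (v - u)) u))"
  let ?I = "\<integral>\<^sup>+(s::real). ennreal (exp (- \<beta> * s\<^sup>2)) \<partial>lborel"
  have "(\<lambda>(\<tau>, u). ?k \<tau> u) \<in> borel_measurable (lborel \<Otimes>\<^sub>M lborel)"
    unfolding gauss_def by measurable
  then have "(\<integral>\<^sup>+\<tau>. (\<integral>\<^sup>+u. ?k \<tau> u \<partial>lborel) \<partial>lborel) = (\<integral>\<^sup>+u. (\<integral>\<^sup>+\<tau>. ?k \<tau> u \<partial>lborel) \<partial>lborel)"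
    by (rule lborel_pair.Fubini'[symmetric])
  also have "\<dots> = (\<integral>\<^sup>+u. ennreal (4 * pi * exp (- \<beta> * (norm u)\<^sup>2)) *
      (\<integral>\<^sup>+\<tau>. ennreal (norm (v - u) * exp (- \<beta> * (norm (x + \<tau> *\<^sub>R (v - u)))\<^sup>2)) \<partial>lborel) \<partial>lborel)"
    by (subst nn_integral_cmult[symmetric])
       (auto simp: gauss_def exp_add[symmetric] ennreal_mult[symmetric] algebra_simps)
  also have "\<dots> \<le> (\<integral>\<^sup>+u. ennreal (4 * pi * exp (- \<beta> * (norm (u::vec3))\<^sup>2)) * ?I \<partial>lborel)"
    by (intro nn_integral_mono mult_left_mono nn_integral_gaussian_line_le assms) auto
  also have "\<dots> = (\<integral>\<^sup>+u. ennreal (4 * pi * exp (- \<beta> * (norm (u::vec3))\<^sup>2)) \<partial>lborel) * ?I"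
    by (rule nn_integral_multc) auto
  also have "?I = ennreal (\<integral>s. exp (- \<beta> * s\<^sup>2) \<partial>lborel)"
    by (rule nn_integral_eq_integral[OF integrable_gaussian_real[OF assms]]) auto
  also have "(\<integral>\<^sup>+u. ennreal (4 * pi * exp (- \<beta> * (norm (u::vec3))\<^sup>2)) \<partial>lborel)
      = ennreal (\<integral>u. 4 * pi * exp (- \<beta> * (norm (u::vec3))\<^sup>2) \<partial>lborel)"
    by (rule nn_integral_eq_integral[OF integrable_mult_right[OF integrable_gaussian[OF assms]]]) auto
  also have "\<dots> * ennreal (\<integral>s. exp (- \<beta> * s\<^sup>2) \<partial>lborel) = ennreal (dispersion_const \<beta>)"
    by (subst ennreal_mult[symmetric]) (auto simp: dispersion_const_def ac_simps)
  finally show ?thesis .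
qed

definition duhamel :: "real \<Rightarrow> (real \<times> vec3 \<times> vec3 \<Rightarrow> real) \<Rightarrow> real \<times> vec3 \<times> vec3 \<Rightarrow> real" where
  "duhamel \<theta> K = (\<lambda>(t, y). \<integral>\<tau>\<in>{0..max t 0}. collision_along \<theta> K (\<tau>, y) \<partial>lborel)"

lemma continuous_on_duhamel:
  assumes "\<bar>\<theta>\<bar> \<le> 1" "\<beta> > 0" "dominated \<beta> R K"
  shows "continuous_on UNIV (duhamel \<theta> K)"
  unfolding duhamel_def by (intro continuous_on_time_integral continuous_on_collision_along[OF assms])

text \<open>The weight \<open>gauss \<beta> x v\<close> does not depend on \<open>\<tau>\<close> or
  \<open>u\<close>, so it leaves both integrals unchanged, and
  \<open>nn_integral_dispersion_le\<close> bounds what remains. Nonnegative extended integrals are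
  used so that no growth in \<open>t\<close> enters.\<close>

lemma duhamel_diff_le:
  assumes \<theta>: "\<bar>\<theta>\<bar> \<le> 1" and \<beta>: "\<beta> > 0" and K: "dominated \<beta> R K" and L: "dominated \<beta> R L"
    and KL: "\<And>t x v. \<bar>K (t, x, v) - L (t, x, v)\<bar> \<le> \<delta> * gauss \<beta> x v"
  shows "\<bar>duhamel \<theta> K (t, x, v) - duhamel \<theta> L (t, x, v)\<bar>
    \<le> dispersion_const \<beta> * lip_const R * \<delta> * gauss \<beta> x v"
proof -
  have \<beta>': "\<beta> \<ge> 0" using \<beta> by simp
  have "0 \<le> \<delta> * gauss \<beta> 0 0"
    using KL[of 0 0 0] by linarith
  then have \<delta>: "\<delta> \<ge> 0" by (simp add: zero_le_mult_iff)
  define A where "A = \<delta> * lip_const R * gauss \<beta> x v"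
  have A: "A \<ge> 0" using \<delta> lip_const_nonneg[OF dominated_nonneg[OF K]] by (simp add: A_def)
  define q where "q K \<tau> = collision_along \<theta> K (\<tau>, x, v)" for K \<tau>
  let ?k = "\<lambda>\<tau> u. 4 * pi * (norm (v - u) * gauss \<beta> (x + \<tau> *\<^sub>R (v - u)) u)"
  have int: "set_integrable lborel {0..max t 0} (q K)" if "dominated \<beta> R K" for K
    unfolding q_def
    by (intro borel_integrable_atLeastAtMost' continuous_intros
        continuous_on_compose2[OF continuous_on_collision_along[OF \<theta> \<beta> that] _ subset_UNIV])
  have q: "ennreal \<bar>q K \<tau> - q L \<tau>\<bar> \<le> ennreal A * (\<integral>\<^sup>+u. ?k \<tau> u \<partial>lborel)" for \<tau>
  proof -
    note int = integrable_sphere_integral[OF \<theta> \<beta>, of R _ "(\<tau>, x, v)"]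
    have "q K \<tau> - q L \<tau> = (\<integral>u. sphere_integral \<theta> K (\<tau>, x, v) u - sphere_integral \<theta> L (\<tau>, x, v) u \<partial>lborel)"
      unfolding q_def collision_along_eq
      by (rule Bochner_Integration.integral_diff[OF int[OF K] int[OF L], symmetric])
    then have "ennreal \<bar>q K \<tau> - q L \<tau>\<bar>
        \<le> (\<integral>\<^sup>+u. ennreal \<bar>sphere_integral \<theta> K (\<tau>, x, v) u - sphere_integral \<theta> L (\<tau>, x, v) u\<bar> \<partial>lborel)"
      using integral_norm_bound_ennreal[OF Bochner_Integration.integrable_diff[OF int[OF K] int[OF L]]]
      by (simp only: real_norm_def)
    also have "\<dots> \<le> (\<integral>\<^sup>+u. ennreal (A * ?k \<tau> u) \<partial>lborel)"
    proof (intro nn_integral_mono ennreal_leI)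
      fix u
      show "\<bar>sphere_integral \<theta> K (\<tau>, x, v) u - sphere_integral \<theta> L (\<tau>, x, v) u\<bar> \<le> A * ?k \<tau> u"
        using sphere_integral_diff_le[OF \<theta> \<beta>' K L KL, of \<tau> x v u]
        unfolding A_def by (simp only: ac_simps)
    qed
    also have "\<dots> = ennreal A * (\<integral>\<^sup>+u. ?k \<tau> u \<partial>lborel)"
      unfolding ennreal_mult'[OF A] by (rule nn_integral_cmult) (simp add: gauss_def)
    finally show ?thesis .
  qed
  have "(\<lambda>(\<tau>, u). ennreal (?k \<tau> u)) \<in> borel_measurable (lborel \<Otimes>\<^sub>M lborel)"
    unfolding gauss_def by measurable
  then have meas: "(\<lambda>\<tau>. \<integral>\<^sup>+u. ?k \<tau> u \<partial>lborel) \<in> borel_measurable lborel"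
    by (rule lborel.borel_measurable_nn_integral)
  let ?f = "\<lambda>\<tau>. indicator {0..max t 0} \<tau> *\<^sub>R q K \<tau> - indicator {0..max t 0} \<tau> *\<^sub>R q L \<tau>"
  have intf: "integrable lborel ?f"
    using int[OF K] int[OF L] by (simp add: set_integrable_def)
  have "duhamel \<theta> K (t, x, v) - duhamel \<theta> L (t, x, v) = (\<integral>\<tau>. ?f \<tau> \<partial>lborel)"
    using Bochner_Integration.integral_diff[OF int[OF K, unfolded set_integrable_def] int[OF L, unfolded set_integrable_def]]
    unfolding duhamel_def set_lebesgue_integral_def q_def prod.case by (rule sym)
  then have "ennreal \<bar>duhamel \<theta> K (t, x, v) - duhamel \<theta> L (t, x, v)\<bar> \<le> (\<integral>\<^sup>+\<tau>. ennreal \<bar>?f \<tau>\<bar> \<partial>lborel)"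
    using integral_norm_bound_ennreal[OF intf] by (simp only: real_norm_def)
  \<comment> \<open>Dropping the indicator enlarges the time interval to the whole line.\<close>
  also have "\<dots> \<le> (\<integral>\<^sup>+\<tau>. ennreal \<bar>q K \<tau> - q L \<tau>\<bar> \<partial>lborel)"
    by (intro nn_integral_mono ennreal_leI) (auto simp: indicator_def)
  also have "\<dots> \<le> (\<integral>\<^sup>+\<tau>. ennreal A * (\<integral>\<^sup>+u. ?k \<tau> u \<partial>lborel) \<partial>lborel)"
    by (intro nn_integral_mono q)
  also have "\<dots> = ennreal A * (\<integral>\<^sup>+\<tau>. (\<integral>\<^sup>+u. ?k \<tau> u \<partial>lborel) \<partial>lborel)"
    by (rule nn_integral_cmult[OF meas])
  also have "\<dots> \<le> ennreal A * ennreal (dispersion_const \<beta>)"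
    by (intro mult_left_mono nn_integral_dispersion_le \<beta>) auto
  also have "\<dots> = ennreal (A * dispersion_const \<beta>)"
    using A by (simp add: ennreal_mult dispersion_const_nonneg)
  finally show ?thesis
    using ennreal_le_iff[OF mult_nonneg_nonneg[OF A dispersion_const_nonneg]]
    by (simp add: A_def ac_simps)
qed

lemma duhamel_zero: "duhamel \<theta> (\<lambda>_. 0) p = 0"
  by (simp add: duhamel_def collision_along_eq sphere_integral_zero set_lebesgue_integral_def split: prod.split)

lemma duhamel_le:
  assumes "\<bar>\<theta>\<bar> \<le> 1" "\<beta> > 0" "dominated \<beta> R K"
  shows "\<bar>duhamel \<theta> K (t, x, v)\<bar> \<le> dispersion_const \<beta> * lip_const R * R * gauss \<beta> x v"
  using duhamel_diff_le[OF assms dominated_zero[OF dominated_nonneg[OF assms(3)]], of R t x v] assms(3)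
  by (simp add: duhamel_zero dominated_def)

section \<open>Contraction in the space of bounded continuous functions\<close>

lemma continuous_on_gauss [continuous_intros]:
  "continuous_on A f \<Longrightarrow> continuous_on A g \<Longrightarrow> continuous_on A (\<lambda>z. gauss \<beta> (f z) (g z))"
  unfolding gauss_def by (intro continuous_intros)

text \<open>
  The norm of \<open>S\<close> becomes the sup norm of bounded continuous functions after dividing by the Gaussian.
  As \<open>duhamel\<close> freezes negative times at \<open>0\<close>, the equation determines \<open>K\<close> for all real \<open>t\<close>.
\<close>
lemma ex1_mild_fixed_point:
  assumes \<theta>: "\<bar>\<theta>\<bar> \<le> 1" and \<beta>: "\<beta> > 0" and R: "R \<ge> 0"
    and small: "dispersion_const \<beta> * lip_const R \<le> 1 / 2"
    and F\<^sub>0: "continuous_on UNIV (\<lambda>(x, v). F\<^sub>0 x v)" "\<And>x v. \<bar>F\<^sub>0 x v\<bar> \<le> R / 2 * gauss \<beta> x v"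
  shows "\<exists>!K. dominated \<beta> R K \<and> (\<forall>t x v. K (t, x, v) = F\<^sub>0 x v + duhamel \<theta> K (t, x, v))"
proof -
  define \<gamma> where "\<gamma> = (\<lambda>p :: real \<times> vec3 \<times> vec3. gauss \<beta> (fst (snd p)) (snd (snd p)))"
  define F where "F = (\<lambda>p :: real \<times> vec3 \<times> vec3. F\<^sub>0 (fst (snd p)) (snd (snd p)))"
  have \<gamma>: "\<gamma> p > 0" for p by (simp add: \<gamma>_def)
  have cont\<gamma>: "continuous_on UNIV \<gamma>"
    unfolding \<gamma>_def by (intro continuous_intros)
  have contF: "continuous_on UNIV F"
    using continuous_on_compose2[OF F\<^sub>0(1) continuous_on_snd[OF continuous_on_id] subset_UNIV, of UNIV]
    by (simp add: F_def case_prod_beta)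
  have dom_iff: "dominated \<beta> R K \<longleftrightarrow> continuous_on UNIV K \<and> (\<forall>p. \<bar>K p\<bar> \<le> R * \<gamma> p)" for K
    by (auto simp: dominated_def \<gamma>_def)
  \<comment> \<open>\<open>st\<close> multiplies the Gaussian back in, and \<open>T\<close> is the
    right-hand side of the mild equation divided by it. The iteration thus runs in a closed ball of
    a complete space.\<close>
  define st where "st g = (\<lambda>p. \<gamma> p * apply_bcontfun g p)" for g :: "(real \<times> vec3 \<times> vec3) \<Rightarrow>\<^sub>C real"
  define T where "T g = (\<lambda>p. (F p + duhamel \<theta> (st g) p) / \<gamma> p)" for g
  let ?B = "cball (0 :: (real \<times> vec3 \<times> vec3) \<Rightarrow>\<^sub>C real) R"
  have st: "dominated \<beta> R (st g)" if "g \<in> ?B" for g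
    unfolding dom_iff
  proof (intro conjI allI)
    show "continuous_on UNIV (st g)"
      unfolding st_def by (intro continuous_intros cont\<gamma>) auto
    fix p
    have "norm (apply_bcontfun g p) \<le> R"
      using norm_bounded[of g p] that by simp
    then show "\<bar>st g p\<bar> \<le> R * \<gamma> p"
      using \<gamma>[of p] by (simp add: st_def abs_mult mult.commute mult_left_mono)
  qed
  \<comment> \<open>The Duhamel term takes one half of the radius and the initial datum the other
    half, so \<open>T\<close> preserves the ball.\<close>
  have duh: "\<bar>duhamel \<theta> (st g) p\<bar> \<le> R / 2 * \<gamma> p" if "g \<in> ?B" for g p
  proof -
    have "dispersion_const \<beta> * lip_const R * (R * \<gamma> p) \<le> 1 / 2 * (R * \<gamma> p)"
      using small R \<gamma>[of p] by (intro mult_right_mono) auto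
    then show ?thesis
      using duhamel_le[OF \<theta> \<beta> st[OF that], of "fst p" "fst (snd p)" "snd (snd p)"]
      by (simp add: \<gamma>_def mult.assoc)
  qed
  have T_le: "\<bar>T g p\<bar> \<le> R" if "g \<in> ?B" for g p
  proof -
    have "\<bar>F p + duhamel \<theta> (st g) p\<bar> \<le> R * \<gamma> p"
      using duh[OF that, of p] F\<^sub>0(2)[of "fst (snd p)" "snd (snd p)"] by (simp add: F_def \<gamma>_def)
    then show ?thesis
      using \<gamma>[of p] by (simp add: T_def field_simps)
  qed
  \<comment> \<open>\<open>Bcontfun\<close> inverts \<open>apply_bcontfun\<close> only on bounded
    continuous functions; this membership makes \<open>Bcontfun (T g)\<close> evaluate to
    \<open>T g\<close>.\<close>
  have T: "T g \<in> bcontfun" if "g \<in> ?B" for g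
  proof (rule bcontfun_normI)
    show "continuous_on UNIV (T g)"
      unfolding T_def using \<gamma>
      by (intro continuous_intros contF cont\<gamma> continuous_on_duhamel[OF \<theta> \<beta> st[OF that]])
         (auto simp: less_imp_neq[symmetric])
    show "norm (T g p) \<le> R" for p using T_le[OF that, of p] by simp
  qed
  have fix_iff: "Bcontfun (T g) = g \<longleftrightarrow> (\<forall>p. st g p = F p + duhamel \<theta> (st g) p)" if "g \<in> ?B" for g
  proof -
    have "Bcontfun (T g) = g \<longleftrightarrow> (\<forall>p. T g p = apply_bcontfun g p)"
      using Bcontfun_inverse[OF T[OF that]] by (metis apply_bcontfun_inverse ext)
    also have "\<dots> \<longleftrightarrow> (\<forall>p. st g p = F p + duhamel \<theta> (st g) p)"
      using \<gamma> by (auto simp: T_def st_def field_simps less_imp_neq[symmetric])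
    finally show ?thesis .
  qed
  have "\<exists>!g\<in>?B. Bcontfun (T g) = g"
  proof (rule Banach_fix[where c="1/2"])
    show "(\<lambda>g. Bcontfun (T g)) ` ?B \<subseteq> ?B"
      using T_le by (auto intro!: norm_bound simp: Bcontfun_inverse T)
    show "dist (Bcontfun (T g)) (Bcontfun (T h)) \<le> 1 / 2 * dist g h" if "g \<in> ?B" "h \<in> ?B" for g h
    proof (rule dist_bound)
      fix p :: "real \<times> vec3 \<times> vec3"
      have "\<bar>st g (t, x, v) - st h (t, x, v)\<bar> \<le> dist g h * gauss \<beta> x v" for t x v
      proof -
        have "\<bar>st g (t, x, v) - st h (t, x, v)\<bar> = gauss \<beta> x v * dist (apply_bcontfun g (t, x, v)) (apply_bcontfun h (t, x, v))"
          by (simp add: st_def \<gamma>_def right_diff_distrib[symmetric] abs_mult dist_real_def)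
        then show ?thesis
          using dist_bounded[of g "(t, x, v)" h] by (simp add: mult.commute mult_left_mono)
      qed
      from duhamel_diff_le[OF \<theta> \<beta> st[OF that(1)] st[OF that(2)] this, of "fst p" "fst (snd p)" "snd (snd p)"]
      have "\<bar>duhamel \<theta> (st g) p - duhamel \<theta> (st h) p\<bar> \<le> dispersion_const \<beta> * lip_const R * (dist g h * \<gamma> p)"
        by (simp add: \<gamma>_def mult.assoc)
      also have "\<dots> \<le> 1 / 2 * (dist g h * \<gamma> p)"
        using small \<gamma>[of p] by (intro mult_right_mono) auto
      finally have *: "\<bar>duhamel \<theta> (st g) p - duhamel \<theta> (st h) p\<bar> \<le> 1 / 2 * dist g h * \<gamma> p"
        by simp
      have "T g p - T h p = (duhamel \<theta> (st g) p - duhamel \<theta> (st h) p) / \<gamma> p"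
        by (simp add: T_def flip: diff_divide_distrib)
      then have "\<bar>T g p - T h p\<bar> \<le> 1 / 2 * dist g h"
        using * \<gamma>[of p] by (simp add: abs_divide pos_divide_le_eq)
      then show "dist (apply_bcontfun (Bcontfun (T g)) p) (apply_bcontfun (Bcontfun (T h)) p) \<le> 1 / 2 * dist g h"
        by (simp add: Bcontfun_inverse[OF T[OF that(1)]] Bcontfun_inverse[OF T[OF that(2)]] dist_real_def)
    qed
  qed (use R in \<open>auto intro: complete_closed_subset\<close>)
  then obtain g where g: "g \<in> ?B" "Bcontfun (T g) = g"
    and g_unique: "\<And>h. h \<in> ?B \<Longrightarrow> Bcontfun (T h) = h \<Longrightarrow> h = g"
    by blast
  have eq: "F (t, x, v) = F\<^sub>0 x v" for t x v by (simp add: F_def)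
  show ?thesis
  proof (rule ex1I[of _ "st g"])
    show "dominated \<beta> R (st g) \<and> (\<forall>t x v. st g (t, x, v) = F\<^sub>0 x v + duhamel \<theta> (st g) (t, x, v))"
      using st[OF g(1)] fix_iff[OF g(1)] g(2) by (metis eq)
    fix K assume K: "dominated \<beta> R K \<and> (\<forall>t x v. K (t, x, v) = F\<^sub>0 x v + duhamel \<theta> K (t, x, v))"
    then have K': "continuous_on UNIV K" "\<And>p. \<bar>K p\<bar> \<le> R * \<gamma> p" "\<And>p. K p = F p + duhamel \<theta> K p"
      by (auto simp: dom_iff F_def)
    \<comment> \<open>Dividing by the Gaussian carries an arbitrary dominated solution
      \<open>K\<close> back into the ball, where uniqueness of the fixed point applies.\<close>
    define k where "k = (\<lambda>p. K p / \<gamma> p)"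
    have k_le: "norm (k p) \<le> R" for p
      using K'(2)[of p] \<gamma>[of p] by (simp add: k_def pos_divide_le_eq)
    have k: "k \<in> bcontfun"
      using \<gamma> by (intro bcontfun_normI[OF _ k_le])
        (auto simp: k_def less_imp_neq[symmetric] intro!: continuous_intros K'(1) cont\<gamma>)
    have stk: "st (Bcontfun k) = K"
      unfolding st_def Bcontfun_inverse[OF k]
      using \<gamma> by (simp add: k_def fun_eq_iff less_imp_neq[symmetric])
    have kB: "Bcontfun k \<in> ?B"
      using k_le by (auto intro!: norm_bound simp: Bcontfun_inverse[OF k])
    then have "Bcontfun (T (Bcontfun k)) = Bcontfun k"
      using K'(3) by (simp add: fix_iff stk)
    then show "K = st g" using g_unique[OF kB] stk by simp
  qed
qed

subsection \<open>Mild solutions\<close>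

text \<open>A real supremum can be compared with \<open>R\<close> pointwise only if the weighted
  values are bounded above, which membership in \<open>S \<beta>\<close> supplies.\<close>

lemma S_ball_iff:
  "F \<in> S_ball \<beta> R \<longleftrightarrow> F \<in> S \<beta> \<and> (\<forall>t\<ge>0. \<forall>x v. \<bar>F t x v\<bar> \<le> R * gauss \<beta> x v)"
proof -
  have "S_norm \<beta> F \<le> R \<longleftrightarrow> (\<forall>t\<ge>0. \<forall>x v. \<bar>F t x v\<bar> \<le> R * gauss \<beta> x v)" if F: "F \<in> S \<beta>"
  proof -
    let ?w = "\<lambda>(t, x, v). weight \<beta> x v * \<bar>F t x v\<bar>"
    obtain c where c: "\<And>t x v. t \<ge> 0 \<Longrightarrow> \<bar>F t x v\<bar> \<le> c * gauss \<beta> x v"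
      using F by (auto simp: S_def gauss_def)
    have le: "weight \<beta> x v * \<bar>F t x v\<bar> \<le> r \<longleftrightarrow> \<bar>F t x v\<bar> \<le> r * gauss \<beta> x v" for t x v r
      by (simp add: weight_eq pos_divide_le_eq)
    have "bdd_above (?w ` ({0..} \<times> UNIV \<times> UNIV))"
      using c by (intro bdd_aboveI2[where M=c]) (auto simp: le)
    then show ?thesis
      unfolding S_norm_def by (subst cSUP_le_iff) (auto simp: le)
  qed
  then show ?thesis by (auto simp: S_ball_def)
qed

lemma S_init_norm_le_iff:
  assumes "F\<^sub>0 \<in> S_init \<beta>"
  shows "S_init_norm \<beta> F\<^sub>0 \<le> R \<longleftrightarrow> (\<forall>x v. \<bar>F\<^sub>0 x v\<bar> \<le> R * gauss \<beta> x v)"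
proof -
  obtain c where c: "\<And>x v. \<bar>F\<^sub>0 x v\<bar> \<le> c * gauss \<beta> x v"
    using assms by (auto simp: S_init_def gauss_def)
  have le: "weight \<beta> x v * \<bar>F\<^sub>0 x v\<bar> \<le> r \<longleftrightarrow> \<bar>F\<^sub>0 x v\<bar> \<le> r * gauss \<beta> x v" for x v r
    by (simp add: weight_eq pos_divide_le_eq)
  have "bdd_above (range (\<lambda>(x, v). weight \<beta> x v * \<bar>F\<^sub>0 x v\<bar>))"
    using c by (intro bdd_aboveI2[where M=c]) (auto simp: le)
  then show ?thesis
    unfolding S_init_norm_def by (subst cSUP_le_iff) (auto simp: le)
qed

text \<open>For each velocity \<open>w\<close> the two shifts by \<open>t *\<^sub>R w\<close>
  cancel, so all colliding particles sit at the common position \<open>x + t *\<^sub>R v\<close>.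
  Agreement at the one time \<open>t\<close> is enough.\<close>

lemma collision_along_sharp:
  assumes "\<And>x v. K (t, x, v) = sharp F t x v"
  shows "collision_along \<theta> K (t, x, v) = sharp (Q \<theta> F) t x v"
proof -
  have "along K (t, x, v) = F t (x + t *\<^sub>R v)"
    by (simp add: along_def assms sharp_def fun_eq_iff algebra_simps)
  then show ?thesis by (simp add: collision_along_def sharp_def Q_def)
qed

text \<open>The integration runs over nonnegative times only, so the values of \<open>K\<close> at
  negative times do not matter.\<close>

lemma duhamel_sharp:
  assumes "\<And>t x v. t \<ge> 0 \<Longrightarrow> K (t, x, v) = sharp F t x v"
  shows "duhamel \<theta> K (t, x, v) = (\<integral>\<tau>\<in>{0..max t 0}. sharp (Q \<theta> F) \<tau> x v \<partial>lborel)"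
  unfolding duhamel_def prod.case
  by (intro set_lebesgue_integral_cong) (auto simp: collision_along_sharp assms)

theorem theorem1p7:
  fixes \<theta> \<beta> :: real
  assumes "\<theta> \<in> {-1, 1}" and "\<beta> > 0"
  shows "\<exists>R\<^sub>0>0. \<forall>F\<^sub>0 \<in> S_init \<beta>. S_init_norm \<beta> F\<^sub>0 \<le> R\<^sub>0 / 2 \<longrightarrow>
           (\<exists>F. mild_solution \<theta> \<beta> F\<^sub>0 F \<and> sharp F \<in> S_ball \<beta> R\<^sub>0 \<and>
              (\<forall>G. mild_solution \<theta> \<beta> F\<^sub>0 G \<and> sharp G \<in> S_ball \<beta> R\<^sub>0 \<longrightarrow>
                 (\<forall>t\<ge>0. \<forall>x v. G t x v = F t x v)))"
proof -
  define D where "D = dispersion_const \<beta>"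
  have D: "D \<ge> 0" by (simp add: D_def dispersion_const_nonneg)
  \<comment> \<open>\<open>lip_const R \<le> 16 R\<close> for \<open>R \<le> 1\<close>, so this choice makes the Lipschitz constant at most \<open>1/2\<close>.\<close>
  define R where "R = 1 / (32 * (D + 1))"
  have R: "R > 0" "R \<le> 1" "32 * (D * R) \<le> 1"
    using D by (auto simp: R_def divide_simps)
  have "lip_const R \<le> 16 * R"
    using R mult_left_mono[of R 1 R] by (simp add: lip_const_def power2_eq_square)
  then have "D * lip_const R \<le> D * (16 * R)"
    using D by (rule mult_left_mono)
  then have small: "dispersion_const \<beta> * lip_const R \<le> 1 / 2"
    using R(3) by (simp add: D_def)
  have \<theta>: "\<bar>\<theta>\<bar> \<le> 1" using assms(1) by auto
  show ?thesis
  proof (intro exI[of _ R] conjI ballI impI R(1))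
    fix F\<^sub>0 assume F\<^sub>0: "F\<^sub>0 \<in> S_init \<beta>" "S_init_norm \<beta> F\<^sub>0 \<le> R / 2"
    have cont: "continuous_on UNIV (\<lambda>(x, v). F\<^sub>0 x v)"
      using F\<^sub>0(1) by (simp add: S_init_def)
    have bound: "\<bar>F\<^sub>0 x v\<bar> \<le> R / 2 * gauss \<beta> x v" for x v
      using F\<^sub>0(2) S_init_norm_le_iff[OF F\<^sub>0(1)] by blast
    obtain K where K: "dominated \<beta> R K" "\<And>t x v. K (t, x, v) = F\<^sub>0 x v + duhamel \<theta> K (t, x, v)"
      and K_unique: "\<And>L. dominated \<beta> R L \<Longrightarrow> (\<And>t x v. L (t, x, v) = F\<^sub>0 x v + duhamel \<theta> L (t, x, v)) \<Longrightarrow> L = K"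
      using ex1_mild_fixed_point[OF \<theta> assms(2) less_imp_le[OF R(1)] small cont bound] by blast
    \<comment> \<open>Transporting the fixed point back along free streaming makes
      \<open>sharp F\<close> equal to it.\<close>
    define F where "F t x v = K (t, x - t *\<^sub>R v, v)" for t x v
    have sharpF: "sharp F t x v = K (t, x, v)" for t x v
      by (simp add: sharp_def F_def)
    have FS: "sharp F \<in> S \<beta>"
      unfolding S_def mem_Collect_eq sharpF
    proof (intro conjI exI[of _ R] R(1) allI impI)
      show "continuous_on ({0..} \<times> UNIV \<times> UNIV) (\<lambda>(t, x, v). K (t, x, v))"
        using K(1) by (auto simp: dominated_def intro: continuous_on_subset)
      show "\<bar>K (t, x, v)\<bar> \<le> R * exp (- \<beta> * ((norm x)\<^sup>2 + (norm v)\<^sup>2))" for t x v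
        using K(1) by (simp add: dominated_def gauss_def)
    qed
    have "mild_solution \<theta> \<beta> F\<^sub>0 F"
      using K(2) duhamel_sharp[of K F] by (simp add: mild_solution_def FS sharpF)
    moreover have "sharp F \<in> S_ball \<beta> R"
      using K(1) by (simp add: S_ball_iff FS sharpF dominated_def)
    moreover have "G t x v = F t x v"
      if G: "mild_solution \<theta> \<beta> F\<^sub>0 G \<and> sharp G \<in> S_ball \<beta> R" and t: "t \<ge> 0" for G t x v
    proof -
      \<comment> \<open>Freezing \<open>sharp G\<close> at time 0 for negative times makes it
        continuous on the whole space and a solution for all real \<open>t\<close>, because
        \<open>duhamel\<close> is frozen in the same way.\<close>
      define L where "L = (\<lambda>(t, x, v). sharp G (max t 0) x v)"
      have "continuous_on ({0..} \<times> UNIV \<times> UNIV) (\<lambda>(t, x, v). sharp G t x v)"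
        using G by (simp add: mild_solution_def S_def)
      then have "continuous_on UNIV (\<lambda>z. (\<lambda>(t, x, v). sharp G t x v) (max (fst z) 0, snd z))"
        by (rule continuous_on_compose2) (auto intro!: continuous_intros)
      then have "dominated \<beta> R L"
        using G by (simp add: dominated_def L_def S_ball_iff case_prod_beta)
      moreover have "L (t, x, v) = F\<^sub>0 x v + duhamel \<theta> L (t, x, v)" for t x v
        using G duhamel_sharp[of L G] by (simp add: L_def mild_solution_def)
      ultimately have "L = K" by (rule K_unique)
      then have "sharp G t y v = sharp F t y v" for y
        using t by (auto simp: L_def sharpF)
      \<comment> \<open>Evaluation at the shifted position undoes the translation inside
        \<open>sharp\<close>.\<close>
      from this[of "x - t *\<^sub>R v"] show ?thesis by (simp add: sharp_def)
    qed
    ultimately show "\<exists>F. mild_solution \<theta> \<beta> F\<^sub>0 F \<and> sharp F \<in> S_ball \<beta> R \<and>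
        (\<forall>G. mild_solution \<theta> \<beta> F\<^sub>0 G \<and> sharp G \<in> S_ball \<beta> R \<longrightarrow>
           (\<forall>t\<ge>0. \<forall>x v. G t x v = F t x v))"
      by blast
  qed
qed

end
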